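(* Let $a<b$ be real numbers, let $M\colon[a,b]\to\mathbb{R}$ be non-decreasing, and let $N\colon[M(a),M(b)]\to\mathbb{R}$ be non-decreasing. Let \[H=\{y\in[M(a),M(b)] : M^{-1}[\{y\}]\text{ contains more than one point}\}\] (a countable set), and define $X,\Xi\colon[M(a),M(b)]\to[a,b]$ by $X(y)=\inf\{x\in[a,b]: y\le M(x)\}$ and $\Xi(y)=\sup\{x\in[a,b]: M(x)\le y\}$. For $y\in H$ let $\Delta N(y,-)=N(y)-N(y-)$ and $\Delta N(y,+)=N(y+)-N(y)$ (with the conventions $N(M(a)-)=N(M(a))$ and $N(M(b)+)=N(M(b))$), and let \[N_1=N-\sum_{y\in H}\Big(\Delta N(y,-)\,\mathbf 1_{[y,M(b)]}+\Delta N(y,+)\,\mathbf 1_{(y,M(b)]}\Big),\] the non-decreasing function obtained from $N$ by removing its jumps at the points of $H$. Then for each bounded Borel function $f\colon[a,b]\to\mathbb{R}$, \[\int_a^b f(x)\,dN(M(x))=\int_{M(a)}^{M(b)} f(X(y))\,dN_1(y)+\sum_{y\in H} f(X(y))\,\Delta N(y,-)+\sum_{y\in H} f(\Xi(y))\,\Delta N(y,+).\] Furthermore, the same identity holds with $X$ replaced by $\Xi$ in the first term on the right-hand side, i.e. $\int_{M(a)}^{M(b)} f(X(y))\,dN_1(y)=\int_{M(a)}^{M(b)} f(\Xi(y))\,dN_1(y)$.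
   Context: "Non-decreasing" is what the paper calls increasing. For a non-decreasing function $F\colon[c,d]\to\mathbb{R}$, the measure corresponding to $F$ is the unique Borel measure $\mu$ on $[c,d]$ such that for every continuous $f\colon[c,d]\to\mathbb{R}$, $\int_{[c,d]} f\,d\mu$ equals the Riemann–Stieltjes integral $\int_c^d f(x)\,dF(x)$. For a bounded Borel function $f$, the Lebesgue–Stieltjes integral $\int_c^d f(x)\,dF(x)$ is defined as $\int_{[c,d]} f\,d\mu$. The notation $\int_a^b f(x)\,dN(M(x))$ means $\int_a^b f(x)\,d\Lambda(x)$ with $\Lambda=N\circ M$. The sum defining $N_1$ converges uniformly since the jumps are summable. *)

theory Defs
  imports "HOL-Analysis.Analysis"
begin

definition RS_has_integral :: "real \<Rightarrow> real \<Rightarrow> (real \<Rightarrow> real) \<Rightarrow> (real \<Rightarrow> real) \<Rightarrow> real \<Rightarrow> bool" where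
  "RS_has_integral c d F f I \<longleftrightarrow>
     (\<forall>\<epsilon>>0. \<exists>\<delta>>0. \<forall>(n::nat) (x::nat \<Rightarrow> real) (t::nat \<Rightarrow> real).
        x 0 = c \<and> x n = d \<and> (\<forall>i<n. x i < x (Suc i) \<and> x (Suc i) - x i < \<delta>)
        \<and> (\<forall>i<n. x i \<le> t i \<and> t i \<le> x (Suc i))
        \<longrightarrow> \<bar>(\<Sum>i<n. f (t i) * (F (x (Suc i)) - F (x i))) - I\<bar> < \<epsilon>)"

definition LS_measure :: "real \<Rightarrow> real \<Rightarrow> (real \<Rightarrow> real) \<Rightarrow> real measure" where
  "LS_measure c d F = (THE \<mu>. sets \<mu> = sets (restrict_space borel {c..d}) \<and> finite_measure \<mu> \<and>
      (\<forall>f. continuous_on {c..d} f \<longrightarrow> RS_has_integral c d F f (integral\<^sup>L \<mu> f)))"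

definition LS_integral :: "real \<Rightarrow> real \<Rightarrow> (real \<Rightarrow> real) \<Rightarrow> (real \<Rightarrow> real) \<Rightarrow> real" where
  "LS_integral c d F f = integral\<^sup>L (LS_measure c d F) f"

definition left_lim_on :: "real \<Rightarrow> (real \<Rightarrow> real) \<Rightarrow> real \<Rightarrow> real" where
  "left_lim_on c N y = (if y = c then N y else Lim (at_left y) N)"

definition right_lim_on :: "real \<Rightarrow> (real \<Rightarrow> real) \<Rightarrow> real \<Rightarrow> real" where
  "right_lim_on d N y = (if y = d then N y else Lim (at_right y) N)"

end

theory Submission
  imports Defs "HOL-Probability.Distribution_Functions"
begin

text \<open>
  For non-decreasing \<open>F\<close> on \<open>[c, d]\<close>, the Lebesgue--Stieltjes measure of \<open>F\<close> is the image of Lebesgue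
  measure on \<open>(F c, F d]\<close> under the generalised inverse \<open>u \<mapsto> inf {x. u \<le> F x}\<close>. Let \<open>Y\<close> and \<open>q\<close> be
  the generalised inverses of \<open>N\<close> and \<open>N \<circ> M\<close>. Then \<open>X (Y u) \<le> q u \<le> \<Xi> (Y u)\<close>, with equality
  throughout if \<open>Y u \<notin> H\<close>. If \<open>y = Y u \<in> H\<close>, then \<open>q u\<close> is \<open>X y\<close> for \<open>u \<le> N y\<close> and \<open>\<Xi> y\<close> for
  \<open>u > N y\<close>; these two sets of \<open>u\<close> have lengths \<open>\<Delta>N(y,-)\<close> and \<open>\<Delta>N(y,+)\<close>. Removing the jumps at \<open>H\<close>
  from \<open>N\<close> amounts to restricting Lebesgue measure to \<open>{u. Y u \<notin> H}\<close>, so the asserted identity is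
  the decomposition of \<open>\<integral> f (q u) du\<close> over these sets.
\<close>

section \<open>Generalised inverses of a monotone function\<close>

text \<open>Meaningful for \<open>u \<le> F d\<close>, where \<open>d\<close> belongs to the set and
  the infimum is not over the empty set. With \<open>F = M\<close> this is \<open>X\<close>; with
  \<open>F = N\<close> and \<open>F = N \<circ> M\<close> it gives \<open>Y\<close> and
  \<open>q\<close> of the main proof.\<close>

definition quantile :: "real \<Rightarrow> real \<Rightarrow> (real \<Rightarrow> real) \<Rightarrow> real \<Rightarrow> real" where
  "quantile c d F u = Inf {x \<in> {c..d}. u \<le> F x}"

text \<open>Meaningful for \<open>F c \<le> u\<close>, where \<open>c\<close> belongs to the set.
  With \<open>F = M\<close> this is \<open>Xi\<close>.\<close>

definition upper_quantile :: "real \<Rightarrow> real \<Rightarrow> (real \<Rightarrow> real) \<Rightarrow> real \<Rightarrow> real" where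
  "upper_quantile c d F u = Sup {x \<in> {c..d}. F x \<le> u}"

lemma quantile_le:
  assumes "x \<in> {c..d}" "u \<le> F x"
  shows "quantile c d F u \<le> x"
  unfolding quantile_def by (rule cInf_lower) (use assms in \<open>auto intro!: bdd_belowI[of _ c]\<close>)

lemma quantile_ge:
  assumes "c \<le> d" "u \<le> F d" "\<And>x. x \<in> {c..d} \<Longrightarrow> u \<le> F x \<Longrightarrow> z \<le> x"
  shows "z \<le> quantile c d F u"
  unfolding quantile_def by (rule cInf_greatest) (use assms in auto)

lemma quantile_in:
  assumes "c \<le> d" "u \<le> F d"
  shows "quantile c d F u \<in> {c..d}"
  using quantile_le[of d c d u F] quantile_ge[of c d u F c] assms by auto

text \<open>The converse of \<open>quantile_le\<close>, with a strict inequality: without right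
  continuity of \<open>F\<close> the infimum need not be attained, so
  \<open>quantile c d F u = x\<close> would not give \<open>u \<le> F x\<close>.\<close>

lemma le_of_quantile_less:
  assumes "mono_on {c..d} F" "x \<in> {c..d}" "quantile c d F u < x" "u \<le> F d"
  shows "u \<le> F x"
proof (rule ccontr)
  assume n: "\<not> u \<le> F x"
  have "x \<le> quantile c d F u"
  proof (rule quantile_ge)
    fix z assume "z \<in> {c..d}" "u \<le> F z"
    then show "x \<le> z"
      using n assms(1,2) mono_onD[of "{c..d}" F z x] by (cases "x \<le> z") auto
  qed (use assms in auto)
  then show False using assms by simp
qed

lemma quantile_ge_of_less:
  assumes "mono_on {c..d} F" "x \<in> {c..d}" "F x < u" "u \<le> F d"
  shows "x \<le> quantile c d F u"
  using le_of_quantile_less[of c d F x u] assms by fastforce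

lemma quantile_mono:
  assumes "c \<le> d"
  shows "mono_on {..F d} (quantile c d F)"
proof (rule mono_onI)
  fix u v assume "u \<in> {..F d}" "v \<in> {..F d}" "u \<le> v"
  then show "quantile c d F u \<le> quantile c d F v"
    using assms by (intro quantile_ge) (auto intro!: quantile_le)
qed

lemma upper_quantile_ge:
  assumes "x \<in> {c..d}" "F x \<le> u"
  shows "x \<le> upper_quantile c d F u"
  unfolding upper_quantile_def by (rule cSup_upper) (use assms in \<open>auto intro!: bdd_aboveI[of _ d]\<close>)

lemma upper_quantile_le:
  assumes "c \<le> d" "F c \<le> u" "\<And>x. x \<in> {c..d} \<Longrightarrow> F x \<le> u \<Longrightarrow> x \<le> z"
  shows "upper_quantile c d F u \<le> z"
  unfolding upper_quantile_def by (rule cSup_least) (use assms in auto)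

lemma upper_quantile_in:
  assumes "c \<le> d" "F c \<le> u"
  shows "upper_quantile c d F u \<in> {c..d}"
  using upper_quantile_ge[of c c d F u] upper_quantile_le[of c d F u d] assms by auto

lemma upper_quantile_mono:
  assumes "c \<le> d"
  shows "mono_on {F c..} (upper_quantile c d F)"
proof (rule mono_onI)
  fix u v assume "u \<in> {F c..}" "v \<in> {F c..}" "u \<le> v"
  then show "upper_quantile c d F u \<le> upper_quantile c d F v"
    using assms by (intro upper_quantile_le) (auto intro!: upper_quantile_ge)
qed

lemma quantile_measurable:
  assumes "c \<le> d" "E \<subseteq> {..F d}"
  shows "quantile c d F \<in> restrict_space borel E \<rightarrow>\<^sub>M restrict_space borel {c..d}"
proof (rule measurable_restrict_space2)
  show "quantile c d F \<in> space (restrict_space borel E) \<rightarrow> {c..d}"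
    using assms quantile_in[of c d _ F] by (auto simp: space_restrict_space subset_iff)
  show "quantile c d F \<in> borel_measurable (restrict_space borel E)"
    using mono_on_subset[OF quantile_mono[OF assms(1), of F] assms(2)] by (rule borel_measurable_mono_on_fnc)
qed

lemma upper_quantile_measurable:
  assumes "c \<le> d" "E \<subseteq> {F c..}"
  shows "upper_quantile c d F \<in> restrict_space borel E \<rightarrow>\<^sub>M restrict_space borel {c..d}"
proof (rule measurable_restrict_space2)
  show "upper_quantile c d F \<in> space (restrict_space borel E) \<rightarrow> {c..d}"
    using assms upper_quantile_in[of c d F] by (auto simp: space_restrict_space subset_iff)
  show "upper_quantile c d F \<in> borel_measurable (restrict_space borel E)"
    using mono_on_subset[OF upper_quantile_mono[OF assms(1), of F] assms(2)]
    by (rule borel_measurable_mono_on_fnc)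
qed

lemma set_integrable_bounded_measurable:
  fixes g :: "real \<Rightarrow> real"
  assumes E: "E \<in> sets lborel" "emeasure lborel E < \<infinity>"
    and g: "g \<in> borel_measurable (restrict_space borel E)" and B: "\<And>u. u \<in> E \<Longrightarrow> \<bar>g u\<bar> \<le> B"
  shows "set_integrable lborel E g"
proof -
  have m: "(\<lambda>x. indicator E x *\<^sub>R g x) \<in> borel_measurable lborel"
    using g E by (subst (asm) borel_measurable_restrict_space_iff) auto
  show ?thesis unfolding set_integrable_def
    using E m B by (intro integrableI_bounded_set[where A=E and B=B]) auto
qed

section \<open>Uniqueness of the Riemann-Stieltjes integral and of the representing measure\<close>

text \<open>One tagged partition finer than both moduli has a Riemann sum within
  \<open>\<bar>I - J\<bar> / 2\<close> of both candidates, which is absurd if they differ.\<close>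

lemma RS_has_integral_unique:
  assumes cd: "c \<le> d" and I: "RS_has_integral c d F f I" and J: "RS_has_integral c d F f J"
  shows "I = J"
proof (rule ccontr)
  assume "I \<noteq> J"
  then have e: "\<bar>I - J\<bar> / 2 > 0" by simp
  from I e obtain d1 where d1: "d1 > 0" "\<And>n x t.
        x 0 = c \<and> x n = d \<and> (\<forall>i<n. x i < x (Suc i) \<and> x (Suc i) - x i < d1)
        \<and> (\<forall>i<n. x i \<le> t i \<and> t i \<le> x (Suc i))
        \<Longrightarrow> \<bar>(\<Sum>i<n. f (t i) * (F (x (Suc i)) - F (x i))) - I\<bar> < \<bar>I - J\<bar> / 2"
    unfolding RS_has_integral_def by blast
  from J e obtain d2 where d2: "d2 > 0" "\<And>n x t.
        x 0 = c \<and> x n = d \<and> (\<forall>i<n. x i < x (Suc i) \<and> x (Suc i) - x i < d2)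
        \<and> (\<forall>i<n. x i \<le> t i \<and> t i \<le> x (Suc i))
        \<Longrightarrow> \<bar>(\<Sum>i<n. f (t i) * (F (x (Suc i)) - F (x i))) - J\<bar> < \<bar>I - J\<bar> / 2"
    unfolding RS_has_integral_def by blast
  obtain n x where nx: "x (0::nat) = c" "x n = d"
      "\<And>i. i < n \<Longrightarrow> x i < x (Suc i) \<and> x (Suc i) - x i < min d1 d2"
  \<comment> \<open>Partition points must increase strictly, so a degenerate interval needs the
    empty partition \<open>n = 0\<close>. This case does occur: \<open>M a = M b\<close> when
    \<open>M\<close> is constant.\<close>
  proof (cases "c = d")
    case True
    then show ?thesis using that[of "\<lambda>_. c" 0] by simp
  next
    case False
    obtain n :: nat where n: "(d - c) / min d1 d2 < n" using reals_Archimedean2 by blast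
    have m: "min d1 d2 > 0" using d1 d2 by simp
    have "0 < (d - c) / min d1 d2" using False cd m by simp
    with n have n0: "n > 0" by (cases n) auto
    have nn: "(d - c) / n < min d1 d2" using n m n0 by (simp add: pos_divide_less_eq mult.commute del: min_less_iff_conj min_less_iff_disj)
    have s: "(c + real (Suc i) * (d - c) / n) - (c + real i * (d - c) / n) = (d - c) / n" for i
      using n0 by (simp add: field_simps)
    have p: "(d - c) / n > 0" using False cd n0 by simp
    show ?thesis
    proof (rule that[of "\<lambda>i. c + real i * (d - c) / n" n])
      fix i
      show "c + real i * (d - c) / n < c + real (Suc i) * (d - c) / n \<and>
         (c + real (Suc i) * (d - c) / n) - (c + real i * (d - c) / n) < min d1 d2"
        using s[of i] p nn by linarith
    qed (use n0 in auto)
  qed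
  have "\<bar>(\<Sum>i<n. f (x i) * (F (x (Suc i)) - F (x i))) - I\<bar> < \<bar>I - J\<bar> / 2"
    by (rule d1) (use nx in \<open>auto simp: less_imp_le\<close>)
  moreover have "\<bar>(\<Sum>i<n. f (x i) * (F (x (Suc i)) - F (x i))) - J\<bar> < \<bar>I - J\<bar> / 2"
    by (rule d2) (use nx in \<open>auto simp: less_imp_le\<close>)
  ultimately show False by (auto simp: abs_if field_simps split: if_splits)
qed

text \<open>The indicator of a half-line is a pointwise limit of continuous functions bounded by 1,
  so dominated convergence carries the equality of integrals over to it.\<close>

lemma measure_Iic_eqI_of_integral_continuous:
  fixes \<mu> \<nu> :: "real measure"
  assumes \<mu>: "sets \<mu> = sets (restrict_space borel {c..d})" "finite_measure \<mu>"
    and \<nu>: "sets \<nu> = sets (restrict_space borel {c..d})" "finite_measure \<nu>"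
    and eq: "\<And>f :: real \<Rightarrow> real. continuous_on {c..d} f \<Longrightarrow> integral\<^sup>L \<mu> f = integral\<^sup>L \<nu> f"
  shows "measure \<mu> ({..x} \<inter> {c..d}) = measure \<nu> ({..x} \<inter> {c..d})"
proof -
  \<comment> \<open>\<open>g n\<close> is 1 up to \<open>x\<close> and falls linearly to 0 over a
    length \<open>1 / n\<close>.\<close>
  define g :: "nat \<Rightarrow> real \<Rightarrow> real" where "g n t = max 0 (1 - real n * max 0 (t - x))" for n t
  have gc: "continuous_on S (g n)" for n S
    unfolding g_def by (intro continuous_intros)
  have lim: "(\<lambda>n. g n t) \<longlonglongrightarrow> indicator {..x} t" for t
  proof (cases "t \<le> x")
    case True
    then show ?thesis by (simp add: g_def max_def)
  next
    case False
    obtain n0 :: nat where n0: "1 / (t - x) < n0" using reals_Archimedean2 by blast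
    have "g n t = 0" if "n \<ge> n0" for n
    proof -
      have "1 / (t - x) < real n" using n0 that by linarith
      then show ?thesis using False by (simp add: g_def max_def field_simps)
    qed
    then have "eventually (\<lambda>n. g n t = 0) sequentially" by (auto simp: eventually_sequentially)
    then show ?thesis using False by (simp add: tendsto_eventually)
  qed
  have conv: "(\<lambda>n. integral\<^sup>L \<rho> (g n)) \<longlonglongrightarrow> measure \<rho> ({..x} \<inter> {c..d})"
    if s: "sets \<rho> = sets (restrict_space borel {c..d})" and f: "finite_measure \<rho>" for \<rho>
  proof -
    interpret finite_measure \<rho> by fact
    have sp: "space \<rho> = {c..d}" using sets_eq_imp_space_eq[OF s] by (simp add: space_restrict_space)
    have mb: "h \<in> borel_measurable \<rho>" if "h \<in> borel_measurable borel" for h :: "real \<Rightarrow> real"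
      using measurable_restrict_space1[OF that] by (simp add: measurable_cong_sets[OF s refl])
    have "(\<lambda>n. integral\<^sup>L \<rho> (g n)) \<longlonglongrightarrow> integral\<^sup>L \<rho> (indicator {..x})"
    proof (rule integral_dominated_convergence[where w="\<lambda>_. 1"])
      show "g n \<in> borel_measurable \<rho>" for n
        by (intro mb borel_measurable_continuous_onI gc)
      show "(indicator {..x} :: real \<Rightarrow> real) \<in> borel_measurable \<rho>" by (intro mb) auto
    qed (auto simp: lim, auto simp: g_def)
    then show ?thesis by (simp add: sp)
  qed
  have "(\<lambda>n. integral\<^sup>L \<mu> (g n)) \<longlonglongrightarrow> measure \<nu> ({..x} \<inter> {c..d})"
    using conv[OF \<nu>] by (simp add: eq[OF gc])
  with conv[OF \<mu>] show ?thesis by (rule LIMSEQ_unique)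
qed

text \<open>Both measures are extended by zero to the whole line, where a finite Borel measure is
  determined by its distribution function.\<close>

lemma measure_eqI_of_integral_continuous:
  fixes \<mu> \<nu> :: "real measure"
  assumes \<mu>: "sets \<mu> = sets (restrict_space borel {c..d})" "finite_measure \<mu>"
    and \<nu>: "sets \<nu> = sets (restrict_space borel {c..d})" "finite_measure \<nu>"
    and eq: "\<And>f :: real \<Rightarrow> real. continuous_on {c..d} f \<Longrightarrow> integral\<^sup>L \<mu> f = integral\<^sup>L \<nu> f"
  shows "\<mu> = \<nu>"
proof -
  let ?D = "\<lambda>\<rho>. distr \<rho> borel (\<lambda>x. x)"
  have id: "(\<lambda>x::real. x) \<in> borel_measurable \<rho>"
    if s: "sets \<rho> = sets (restrict_space borel {c..d})" for \<rho>
    using measurable_restrict_space1[of "\<lambda>x::real. x" borel borel] by (simp add: measurable_cong_sets[OF s refl])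
  have sp: "space \<rho> = {c..d}" if s: "sets \<rho> = sets (restrict_space borel {c..d})" for \<rho>
    using sets_eq_imp_space_eq[OF s] by (simp add: space_restrict_space)
  have fb: "finite_borel_measure (?D \<rho>)"
    if s: "sets \<rho> = sets (restrict_space borel {c..d})" "finite_measure \<rho>" for \<rho>
    using finite_measure.finite_measure_distr[OF s(2) id[OF s(1)]]
    by (simp add: finite_borel_measure_def finite_borel_measure_axioms_def)
  have "cdf (?D \<mu>) = cdf (?D \<nu>)"
    using measure_Iic_eqI_of_integral_continuous[OF \<mu> \<nu> eq]
    by (auto simp: cdf_def measure_distr[OF id[OF \<mu>(1)]] measure_distr[OF id[OF \<nu>(1)]]
        sp[OF \<mu>(1)] sp[OF \<nu>(1)])
  then have D: "?D \<mu> = ?D \<nu>"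
    using cdf_unique' fb \<mu> \<nu> by blast
  show ?thesis
  proof (rule measure_eqI)
    show "sets \<mu> = sets \<nu>" using \<mu> \<nu> by simp
    fix A assume "A \<in> sets \<mu>"
    then have A: "A \<subseteq> {c..d}" "A \<in> sets borel" using \<mu> by (auto simp: sets_restrict_space_iff)
    have "emeasure \<rho> A = emeasure (?D \<rho>) A"
      if s: "sets \<rho> = sets (restrict_space borel {c..d})" for \<rho>
      using A by (simp add: emeasure_distr[OF id[OF s]] sp[OF s] Int_absorb2)
    then show "emeasure \<mu> A = emeasure \<nu> A" using D \<mu> \<nu> by metis
  qed
qed

section \<open>Lebesgue-Stieltjes integrals as integrals of the inverse against Lebesgue
  measure\<close>

text \<open>
  \<open>F\<close> is decoupled from \<open>N\<close> so that the result also covers \<open>F = N\<^sub>1\<close>, with \<open>E\<close> a proper subset of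
  \<open>(N c, N d]\<close>.
\<close>

lemma RS_has_integral_quantile:
  fixes F N g :: "real \<Rightarrow> real"
  assumes cd: "c \<le> d" and N: "mono_on {c..d} N"
    and E: "E \<in> sets lborel" "E \<subseteq> {N c<..N d}"
    and F: "\<And>x. x \<in> {c..d} \<Longrightarrow> F x = F c + measure lborel (E \<inter> {..N x})"
    and g: "continuous_on {c..d} g"
  shows "RS_has_integral c d F g (LINT u:E|lborel. g (quantile c d N u))"
  unfolding RS_has_integral_def
proof (intro allI impI)
  fix e :: real assume e: "e > 0"
  let ?q = "quantile c d N"
  have finE: "emeasure lborel E' < \<infinity>" if "E' \<subseteq> E" for E'
  proof -
    have "emeasure lborel E' \<le> emeasure lborel {N c<..N d}" using E that by (intro emeasure_mono) auto
    also have "\<dots> < \<infinity>" using mono_onD[OF N, of c d] cd by simp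
    finally show ?thesis .
  qed
  have gm: "g \<in> borel_measurable (restrict_space borel {c..d})"
    using g by (rule borel_measurable_continuous_on_restrict)
  have gqm: "(\<lambda>u. g (?q u)) \<in> borel_measurable (restrict_space borel E)"
    by (rule measurable_compose[OF quantile_measurable gm]) (use cd E in auto)
  have "compact (g ` {c..d})" using g by (intro compact_continuous_image) auto
  then obtain B where B: "\<And>x. x \<in> {c..d} \<Longrightarrow> \<bar>g x\<bar> \<le> B"
    using compact_imp_bounded by (fastforce simp: bounded_iff)
  have intE: "set_integrable lborel E (\<lambda>u. g (?q u))"
    using E finE[of E] gqm cd by (intro set_integrable_bounded_measurable[where B=B] B quantile_in) auto
  have int: "set_integrable lborel E' (\<lambda>u. g (?q u))" if "E' \<subseteq> E" "E' \<in> sets lborel" for E'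
    using set_integrable_subset[OF intE] that by auto
  \<comment> \<open>The added 1 keeps \<open>K\<close> positive when \<open>E\<close> is a null set
    and makes the final estimate strictly less than \<open>e\<close>.\<close>
  define K where "K = measure lborel E + 1"
  have K: "K > 0" by (simp add: K_def add_nonneg_pos)
  have "uniformly_continuous_on {c..d} g" using g by (intro compact_uniformly_continuous) auto
  then obtain \<delta> where \<delta>: "\<delta> > 0"
    "\<And>x y. x \<in> {c..d} \<Longrightarrow> y \<in> {c..d} \<Longrightarrow> dist y x < \<delta> \<Longrightarrow> dist (g y) (g x) < e / K"
    unfolding uniformly_continuous_on_def using e K by (metis divide_pos_pos)
  show "\<exists>\<delta>>0. \<forall>n x t. x 0 = c \<and> x n = d \<and> (\<forall>i<n. x i < x (Suc i) \<and> x (Suc i) - x i < \<delta>) \<and>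
       (\<forall>i<n. x i \<le> t i \<and> t i \<le> x (Suc i)) \<longrightarrow>
       \<bar>(\<Sum>i<n. g (t i) * (F (x (Suc i)) - F (x i))) - (LINT u:E|lborel. g (?q u))\<bar> < e"
  proof (intro exI[of _ \<delta>] conjI allI impI \<delta>)
    fix n and x t :: "nat \<Rightarrow> real"
    assume as: "x 0 = c \<and> x n = d \<and> (\<forall>i<n. x i < x (Suc i) \<and> x (Suc i) - x i < \<delta>) \<and>
       (\<forall>i<n. x i \<le> t i \<and> t i \<le> x (Suc i))"
    have ge: "i \<le> n \<Longrightarrow> c \<le> x i" for i
    proof (induction i)
      case (Suc i) then show ?case using as by (meson Suc_le_lessD less_imp_le order_trans)
    qed (use as in auto)
    \<comment> \<open>Induction backwards from the right end \<open>x n = d\<close>.\<close>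
    have le: "k \<le> n \<Longrightarrow> x (n - k) \<le> d" for k
    proof (induction k)
      case (Suc k)
      then have "x (n - Suc k) < x (Suc (n - Suc k))" using as by auto
      also have "Suc (n - Suc k) = n - k" using Suc by simp
      finally show ?case using Suc by auto
    qed (use as in auto)
    have xi: "x i \<in> {c..d}" if "i \<le> n" for i
      using ge[OF that] le[of "n - i"] that by auto
    \<comment> \<open>The Riemann sum is compared with the integral one cell at a time: the first
      \<open>k\<close> cells account for the part of \<open>E\<close> up to \<open>N (x k)\<close>,
      and the error is at most \<open>e / K\<close> times its length.\<close>
    have "k \<le> n \<Longrightarrow> \<bar>(\<Sum>i<k. g (t i) * (F (x (Suc i)) - F (x i))) -
        (LINT u:E \<inter> {..N (x k)}|lborel. g (?q u))\<bar> \<le> e / K * measure lborel (E \<inter> {..N (x k)})" for k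
    proof (induction k)
      case 0
      \<comment> \<open>\<open>E\<close> lies strictly above \<open>N c\<close>, so nothing has been
        collected at the left end.\<close>
      have "E \<inter> {..N (x 0)} = {}" using E as by auto
      then show ?case by (simp add: set_lebesgue_integral_def)
    next
      case (Suc k)
      let ?A = "E \<inter> {..N (x k)}" and ?D = "E \<inter> {N (x k)<..N (x (Suc k))}"
      have xk: "x k \<in> {c..d}" "x (Suc k) \<in> {c..d}" using xi[of k] xi[of "Suc k"] Suc.prems by auto
      have xs: "x k < x (Suc k)" "x (Suc k) - x k < \<delta>" "x k \<le> t k" "t k \<le> x (Suc k)"
        using as Suc.prems by auto
      have NN: "N (x k) \<le> N (x (Suc k))" using mono_onD[OF N] xk xs by auto
      have un: "E \<inter> {..N (x (Suc k))} = ?A \<union> ?D" and di: "?A \<inter> ?D = {}" using NN by auto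
      have mA: "?A \<in> sets lborel" and mD: "?D \<in> sets lborel" using E by auto
      have me: "measure lborel (?A \<union> ?D) = measure lborel ?A + measure lborel ?D"
        using mA mD di finE[of ?A] finE[of ?D] by (intro measure_Union) auto
      have dF: "F (x (Suc k)) - F (x k) = measure lborel ?D"
        using F[OF xk(1)] F[OF xk(2)] me unfolding un by linarith
      have spl: "(LINT u:?A \<union> ?D|lborel. g (?q u)) = (LINT u:?A|lborel. g (?q u)) + (LINT u:?D|lborel. g (?q u))"
        using mA mD di by (intro set_integral_Un int) auto
      have cst: "(LINT u:?D|lborel. h) = h * measure lborel ?D" for h :: real
        using mD finE[of ?D] by (simp add: set_lebesgue_integral_def)
      have iD: "set_integrable lborel ?D (\<lambda>u. h)" for h :: real
        using mD finE[of ?D] by (simp add: set_integrable_def integrable_indicator_iff)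
      have "\<bar>(LINT u:?D|lborel. g (t k) - g (?q u))\<bar> \<le> (LINT u:?D|lborel. \<bar>g (t k) - g (?q u)\<bar>)"
        unfolding set_lebesgue_integral_def
        by (rule order_trans[OF integral_abs_bound]) (simp add: abs_mult)
      also have "\<dots> \<le> (LINT u:?D|lborel. e / K)"
      proof (rule set_integral_mono)
        show "set_integrable lborel ?D (\<lambda>u. \<bar>g (t k) - g (?q u)\<bar>)"
          using iD int[of ?D] mD by (intro set_integrable_abs set_integral_diff) auto
        fix u assume u: "u \<in> ?D"
        have uN: "u \<le> N d" using u E by auto
        \<comment> \<open>For \<open>u\<close> in the slice \<open>?D\<close> the inverse lands in
          the same cell as the tag \<open>t k\<close>, so uniform continuity of \<open>g\<close>
          applies.\<close>
        have "x k \<le> ?q u" "?q u \<le> x (Suc k)"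
          using u uN xk by (auto intro!: quantile_le quantile_ge_of_less[OF N])
        then have "dist (t k) (?q u) < \<delta>" "t k \<in> {c..d}" "?q u \<in> {c..d}"
          using xs xk by (auto simp: dist_real_def)
        then show "\<bar>g (t k) - g (?q u)\<bar> \<le> e / K" using \<delta>(2)[of "?q u" "t k"] by (simp add: dist_real_def)
      qed (rule iD)
      also have "\<dots> = e / K * measure lborel ?D" by (rule cst)
      finally have "\<bar>g (t k) * (F (x (Suc k)) - F (x k)) - (LINT u:?D|lborel. g (?q u))\<bar> \<le> e / K * measure lborel ?D"
        using int[of ?D] mD iD[of "g (t k)"] by (simp add: dF cst)
      with Suc show ?case unfolding un spl me by (simp add: distrib_left)
    qed
    from this[of n] have "\<bar>(\<Sum>i<n. g (t i) * (F (x (Suc i)) - F (x i))) -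
        (LINT u:E \<inter> {..N d}|lborel. g (?q u))\<bar> \<le> e / K * measure lborel (E \<inter> {..N d})" using as by simp
    also have "E \<inter> {..N d} = E" using E by auto
    also have "e / K * measure lborel E < e" using e K by (simp add: K_def field_simps)
    finally show "\<bar>(\<Sum>i<n. g (t i) * (F (x (Suc i)) - F (x i))) - (LINT u:E|lborel. g (?q u))\<bar> < e" .
  qed
qed

text \<open>The image of Lebesgue measure on \<open>E\<close> under the inverse of \<open>N\<close>
  represents the Riemann-Stieltjes integral against \<open>F\<close>; by uniqueness it is the
  measure picked by \<open>THE\<close>, and the claim is the image-measure formula.\<close>

lemma LS_integral_quantile:
  fixes F N f :: "real \<Rightarrow> real"
  assumes cd: "c \<le> d" and N: "mono_on {c..d} N"
    and E: "E \<in> sets lborel" "E \<subseteq> {N c<..N d}"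
    and F: "\<And>x. x \<in> {c..d} \<Longrightarrow> F x = F c + measure lborel (E \<inter> {..N x})"
    and f: "f \<in> borel_measurable (restrict_space borel {c..d})"
  shows "LS_integral c d F f = (LINT u:E|lborel. f (quantile c d N u))"
proof -
  let ?\<mu> = "distr (restrict_space lborel E) (restrict_space borel {c..d}) (quantile c d N)"
  have qm: "quantile c d N \<in> restrict_space lborel E \<rightarrow>\<^sub>M restrict_space borel {c..d}"
  proof -
    have "E \<subseteq> {..N d}" using E by auto
    from quantile_measurable[where F=N, OF cd this] show ?thesis
      by (simp cong: measurable_cong_sets sets_restrict_space_cong)
  qed
  have int: "integral\<^sup>L ?\<mu> g = (LINT u:E|lborel. g (quantile c d N u))"
    if "g \<in> borel_measurable (restrict_space borel {c..d})" for g :: "real \<Rightarrow> real"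
    using E by (simp add: integral_distr[OF qm that] integral_restrict_space set_lebesgue_integral_def)
  have "emeasure lborel E \<le> emeasure lborel {N c<..N d}" using E by (intro emeasure_mono) auto
  also have "\<dots> < \<infinity>" using mono_onD[OF N, of c d] cd by simp
  finally have "emeasure lborel E < \<infinity>" .
  then have "finite_measure (restrict_space lborel E)"
    using E by (intro finite_measureI) (simp add: emeasure_restrict_space space_restrict_space less_top)
  then have fin: "finite_measure ?\<mu>" using finite_measure.finite_measure_distr qm by blast
  have RS: "RS_has_integral c d F g (integral\<^sup>L ?\<mu> g)" if "continuous_on {c..d} g" for g
    using RS_has_integral_quantile[OF cd N E F that]
    by (subst int) (auto intro: borel_measurable_continuous_on_restrict that)
  have "LS_measure c d F = ?\<mu>"
    unfolding LS_measure_def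
  proof (rule the_equality)
    fix \<nu> assume \<nu>: "sets \<nu> = sets (restrict_space borel {c..d}) \<and> finite_measure \<nu> \<and>
      (\<forall>f. continuous_on {c..d} f \<longrightarrow> RS_has_integral c d F f (integral\<^sup>L \<nu> f))"
    \<comment> \<open>A competitor has the same integrals of continuous functions, since a
      Riemann-Stieltjes integral has only one value.\<close>
    show "\<nu> = ?\<mu>"
      by (rule measure_eqI_of_integral_continuous[of _ c d])
         (use \<nu> fin RS RS_has_integral_unique[OF cd] in auto)
  qed (use fin RS in auto)
  then show ?thesis by (simp add: LS_integral_def int[OF f])
qed

section \<open>One-sided jumps as lengths of level sets of the inverse\<close>

lemma quantile_vimage_borel:
  assumes "c \<le> d" "v \<le> F d" "S \<in> sets borel"
  shows "{u \<in> {w<..v}. quantile c d F u \<in> S} \<in> sets borel"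
proof -
  let ?E = "{w<..v}"
  have E: "?E \<subseteq> {..F d}" using assms by auto
  have "quantile c d F -` (S \<inter> {c..d}) \<inter> space (restrict_space borel ?E) \<in> sets (restrict_space borel ?E)"
    using quantile_measurable[where F=F, OF assms(1) E]
    by (rule measurable_sets) (use assms in \<open>auto simp: sets_restrict_space_iff\<close>)
  also have "quantile c d F -` (S \<inter> {c..d}) \<inter> space (restrict_space borel ?E) = {u \<in> ?E. quantile c d F u \<in> S}"
    using quantile_in[of c d _ F] assms(1) E by (fastforce simp: space_restrict_space)
  finally show ?thesis by (simp add: sets_restrict_space_iff)
qed

lemma fmeasurable_Collect_Ioc:
  fixes w v :: real
  assumes "{u \<in> {w<..v}. P u} \<in> sets borel"
  shows "{u \<in> {w<..v}. P u} \<in> fmeasurable lborel"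
proof (rule fmeasurableI2)
  show "{w<..v} \<in> fmeasurable lborel" by (cases "w \<le> v") (auto simp: fmeasurable_def)
qed (use assms in auto)

lemma measure_Un_fmeasurable_disjoint:
  assumes "A \<in> fmeasurable M" "B \<in> fmeasurable M" "A \<inter> B = {}"
  shows "measure M (A \<union> B) = measure M A + measure M B"
  using assms by (intro measure_Union) (auto simp: fmeasurable_def)

text \<open>With \<open>s\<close> the left limit at \<open>z\<close>, the level set lies between
  \<open>{s<..N z}\<close> and \<open>{s..N z}\<close>. Whether it contains \<open>s\<close> depends
  on \<open>N\<close> attaining \<open>s\<close> to the left of \<open>z\<close>, but a point has no
  length.\<close>

lemma measure_quantile_left_jump:
  assumes N: "mono_on {c..d} N" and z: "z \<in> {c..d}"
  shows "measure lborel {u \<in> {N c<..N z}. quantile c d N u = z} = N z - left_lim_on c N z"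
proof (cases "z = c")
  case True
  \<comment> \<open>The interval \<open>{N c<..N c}\<close> is empty, in accordance with the
    convention that there is no left jump at \<open>c\<close>.\<close>
  then show ?thesis by (simp add: left_lim_on_def)
next
  case False
  let ?A = "{u \<in> {N c<..N z}. quantile c d N u = z}"
  define s where "s = Sup (N ` ({..<z} \<inter> {c..d}))"
  have le: "N x \<le> N y" if "c \<le> x" "x \<le> y" "y \<le> d" for x y
    using mono_onD[OF N] that by auto
  \<comment> \<open>\<open>N\<close> is monotone only on \<open>{c..d}\<close>, so the limit is
    taken within that set first; near \<open>z > c\<close> this is the same filter as
    \<open>at_left z\<close>.\<close>
  have "(N \<longlongrightarrow> s) (at z within ({..<z} \<inter> {c..d}))"
    unfolding s_def by (rule Lim_left_bound[where K="N z"]) (use z in \<open>auto intro!: le\<close>)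
  also have "at z within ({..<z} \<inter> {c..d}) = at_left z"
    using z False by (intro at_within_nhd[of _ "{c<..}"]) auto
  finally have "Lim (at_left z) N = s" by (intro tendsto_Lim) auto
  then have ll: "left_lim_on c N z = s" using False by (simp add: left_lim_on_def)
  have Ns: "N y \<le> s" if "c \<le> y" "y < z" for y
    unfolding s_def using that z by (intro cSup_upper bdd_aboveI[of _ "N z"]) (auto intro!: le)
  have ne: "c \<in> {..<z} \<inter> {c..d}" using z False by auto
  have sN: "s \<le> v" if "\<And>y. c \<le> y \<Longrightarrow> y < z \<Longrightarrow> N y \<le> v" for v
    unfolding s_def using that ne by (intro cSup_least) (blast, auto)
  have sz: "s \<le> N z" by (rule sN) (use z in \<open>auto intro!: le\<close>)
  have Nzd: "N z \<le> N d" using le[of z d] z by auto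
  have Am: "?A \<in> sets borel"
    using quantile_vimage_borel[of c d "N z" N "{z}" "N c"] z Nzd by auto
  have "{s<..N z} \<subseteq> ?A"
  proof
    fix u assume u: "u \<in> {s<..N z}"
    \<comment> \<open>Every \<open>y\<close> strictly between \<open>c\<close> and \<open>z\<close>
      is a lower bound for the inverse; letting \<open>y\<close> increase to \<open>z\<close> gives
      the bound \<open>z\<close>.\<close>
    have "y \<le> quantile c d N u" if "c < y" "y < z" for y
      using Ns[of y] that u z Nzd by (intro quantile_ge_of_less[OF N]) auto
    then have "z \<le> quantile c d N u"
      using False z dense_le_bounded[of c z "quantile c d N u"] by auto
    moreover have "quantile c d N u \<le> z" using u z by (intro quantile_le) auto
    ultimately show "u \<in> ?A" using u Ns[of c] z False by auto
  qed
  then have "measure lborel {s<..N z} \<le> measure lborel ?A"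
    using fmeasurable_Collect_Ioc[OF Am] by (intro measure_mono_fmeasurable) auto
  moreover have "?A \<subseteq> {s..N z}"
  proof
    fix u assume u: "u \<in> ?A"
    have "s \<le> u"
    proof (rule sN)
      fix y assume "c \<le> y" "y < z"
      then show "N y \<le> u" using quantile_le[of y c d u N] u z by (cases "u \<le> N y") auto
    qed
    then show "u \<in> {s..N z}" using u by auto
  qed
  then have "measure lborel ?A \<le> measure lborel {s..N z}"
    using Am sz by (intro measure_mono_fmeasurable) (auto simp: fmeasurable_def)
  ultimately show ?thesis using sz by (simp add: ll)
qed

text \<open>Here the level set is exactly \<open>{N z<..s}\<close> with \<open>s\<close> the right
  limit: the value \<open>s\<close> is included because \<open>s \<le> N y\<close> for all
  \<open>y > z\<close>, so that the infimum is \<open>z\<close> even if not attained.\<close>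

lemma measure_quantile_right_jump:
  assumes N: "mono_on {c..d} N" and z: "z \<in> {c..d}"
  shows "measure lborel {u \<in> {N z<..N d}. quantile c d N u = z} = right_lim_on d N z - N z"
proof (cases "z = d")
  case True
  then show ?thesis by (simp add: right_lim_on_def)
next
  case False
  let ?A = "{u \<in> {N z<..N d}. quantile c d N u = z}"
  define s where "s = Inf (N ` ({z<..} \<inter> {c..d}))"
  have le: "N x \<le> N y" if "c \<le> x" "x \<le> y" "y \<le> d" for x y
    using mono_onD[OF N] that by auto
  have "(N \<longlongrightarrow> s) (at z within ({z<..} \<inter> {c..d}))"
    unfolding s_def by (rule Lim_right_bound[where K="N z"]) (use z in \<open>auto intro!: le\<close>)
  also have "at z within ({z<..} \<inter> {c..d}) = at_right z"
    using z False by (intro at_within_nhd[of _ "{..<d}"]) auto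
  finally have "Lim (at_right z) N = s" by (intro tendsto_Lim) auto
  then have ll: "right_lim_on d N z = s" using False by (simp add: right_lim_on_def)
  have Ns: "s \<le> N y" if "z < y" "y \<le> d" for y
    unfolding s_def using that z by (intro cInf_lower bdd_belowI[of _ "N z"]) (auto intro!: le)
  have ne: "d \<in> {z<..} \<inter> {c..d}" using z False by auto
  have sN: "v \<le> s" if "\<And>y. z < y \<Longrightarrow> y \<le> d \<Longrightarrow> v \<le> N y" for v
    unfolding s_def using that ne by (intro cInf_greatest) (blast, auto)
  have sz: "N z \<le> s" by (rule sN) (use z in \<open>auto intro!: le\<close>)
  have "?A = {N z<..s}"
  proof safe
    fix u assume u: "u \<in> {N (quantile c d N u)<..N d}" "z = quantile c d N u"
    have "u \<le> s"
    proof (rule sN)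
      fix y assume "z < y" "y \<le> d"
      then show "u \<le> N y" using le_of_quantile_less[OF N, of y u] u z by auto
    qed
    then show "u \<in> {N (quantile c d N u)<..s}" using u by auto
  next
    fix u assume u: "u \<in> {N z<..s}"
    have ud: "u \<le> N d" using u Ns[of d] z False by auto
    then show "u \<in> {N z<..N d}" using u by auto
    have "quantile c d N u \<le> y" if "z < y" "y < d" for y
      using Ns[of y] that u z by (intro quantile_le) auto
    then have "quantile c d N u \<le> z"
      using False z dense_ge_bounded[of z d "quantile c d N u"] by auto
    moreover have "z \<le> quantile c d N u" using u z ud by (intro quantile_ge_of_less[OF N]) auto
    ultimately show "quantile c d N u = z" by simp
  qed
  then show ?thesis using sz by (simp add: ll)
qed

section \<open>Countable additivity of the integral as an unordered sum\<close>

text \<open>After enumerating \<open>H\<close>, the partial unions increase to the whole union and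
  the integrals converge. The same argument for \<open>\<bar>g\<bar>\<close> gives absolute
  summability, which makes the sum independent of the order.\<close>

lemma has_sum_set_integral_UN:
  fixes g :: "'a \<Rightarrow> real"
  assumes H: "countable H" and A: "\<And>z. z \<in> H \<Longrightarrow> A z \<in> sets M" and dis: "disjoint_family_on A H"
    and g: "set_integrable M (\<Union>z\<in>H. A z) g"
  shows "((\<lambda>z. LINT u:A z|M. g u) has_sum (LINT u:(\<Union>z\<in>H. A z)|M. g u)) H"
proof -
  define t where "t = to_nat_on H"
  have t: "inj_on t H" unfolding t_def using H by (rule inj_on_to_nat_on)
  \<comment> \<open>Indices outside the range of the enumeration get the empty set, so finite and
    infinite \<open>H\<close> are treated alike.\<close>
  define B where "B n = (if n \<in> t ` H then A (the_inv_into H t n) else {})" for n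
  have Bt: "B (t z) = A z" if "z \<in> H" for z
    using that t by (simp add: B_def the_inv_into_f_f)
  have Bm: "B n \<in> sets M" for n
    using A t by (auto simp: B_def the_inv_into_f_f)
  have Bd: "B i \<inter> B j = {}" if "i \<noteq> j" for i j
    using that dis t by (force simp: B_def the_inv_into_f_f disjoint_family_on_def)
  have BU: "(\<Union>n. B n) = (\<Union>z\<in>H. A z)"
  proof
    show "(\<Union>n. B n) \<subseteq> (\<Union>z\<in>H. A z)"
      using t by (auto simp: B_def the_inv_into_f_f split: if_splits)
    show "(\<Union>z\<in>H. A z) \<subseteq> (\<Union>n. B n)" using Bt by blast
  qed
  have gU: "set_integrable M (\<Union>n. B n) g" using g BU by simp
  \<comment> \<open>Stated for a general \<open>h\<close> because it is applied both to
    \<open>\<bar>g\<bar>\<close> (summability) and to \<open>g\<close> (value).\<close>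
  have sm: "(\<lambda>n. LINT u:B n|M. h u) sums (LINT u:(\<Union>n. B n)|M. h u)"
    if h: "set_integrable M (\<Union>n. B n) h" for h :: "'a \<Rightarrow> real"
  proof -
    have "(\<lambda>n. LINT u:(\<Union>i<n. B i)|M. h u) \<longlonglongrightarrow> (LINT u:(\<Union>n. \<Union>i<n. B i)|M. h u)"
    proof (rule set_integral_cont_up)
      show "incseq (\<lambda>n. \<Union>i<n. B i)" by (intro monoI UN_mono) auto
      have e: "(\<Union>n. \<Union>i<n. B i) = (\<Union>n. B n)" by auto
      show "set_integrable M (\<Union>n. \<Union>i<n. B i) h" using h by (simp add: e)
    qed (use Bm in auto)
    moreover have "(\<Union>n. \<Union>i<n. B i) = (\<Union>n. B n)" by auto
    moreover have "(LINT u:(\<Union>i<n. B i)|M. h u) = (\<Sum>i<n. LINT u:B i|M. h u)" for n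
    proof (rule set_integral_finite_Union)
      show "set_integrable M (B i) h" for i using set_integrable_subset[OF h Bm] by blast
    qed (use Bm Bd in \<open>auto simp: disjoint_family_on_def\<close>)
    ultimately show ?thesis by (simp add: sums_def)
  qed
  have "summable (\<lambda>n. norm (LINT u:B n|M. g u))"
  proof (rule summable_comparison_test)
    show "summable (\<lambda>n. LINT u:B n|M. \<bar>g u\<bar>)"
      using sm[OF set_integrable_abs[OF gU]] by (rule sums_summable)
    show "\<exists>N. \<forall>n\<ge>N. norm (norm (LINT u:B n|M. g u)) \<le> (LINT u:B n|M. \<bar>g u\<bar>)"
      using integral_abs_bound[of M "\<lambda>u. indicator (B _) u * g u"]
      by (simp add: set_lebesgue_integral_def abs_mult)
  qed
  then have "((\<lambda>n. LINT u:B n|M. g u) has_sum (LINT u:(\<Union>z\<in>H. A z)|M. g u)) UNIV"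
    using sm[OF gU] BU by (intro norm_summable_imp_has_sum) auto
  then have "((\<lambda>n. LINT u:B n|M. g u) has_sum (LINT u:(\<Union>z\<in>H. A z)|M. g u)) (t ` H)"
    by (rule has_sum_cong_neutral[THEN iffD1, rotated -1]) (auto simp: B_def set_lebesgue_integral_def)
  then have "((\<lambda>n. LINT u:B n|M. g u) \<circ> t has_sum (LINT u:(\<Union>z\<in>H. A z)|M. g u)) H"
    using has_sum_reindex[OF t] by blast
  then show ?thesis
    by (rule has_sum_cong[THEN iffD1, rotated]) (simp add: Bt)
qed

section \<open>The inverse of a composition compared with the inverses of its factors\<close>

text \<open>If \<open>u \<le> N (M x)\<close>, then \<open>M x\<close> competes in the infimum for
  the inverse of \<open>N\<close>, and hence \<open>x\<close> competes in the infimum for the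
  inverse of \<open>M\<close>.\<close>

lemma quantile_comp_ge:
  assumes "a \<le> b" and M: "mono_on {a..b} M" and u: "u \<le> N (M b)"
  shows "quantile a b M (quantile (M a) (M b) N u) \<le> quantile a b (N \<circ> M) u"
proof (rule quantile_ge)
  fix x assume x: "x \<in> {a..b}" "u \<le> (N \<circ> M) x"
  then show "quantile a b M (quantile (M a) (M b) N u) \<le> x"
    using mono_onD[OF M, of a x] mono_onD[OF M, of x b] by (intro quantile_le) auto
qed (use assms in auto)

text \<open>A point \<open>x\<close> strictly beyond the right-hand side has \<open>M x\<close>
  strictly above the inverse of \<open>N\<close> at \<open>u\<close>, so
  \<open>u \<le> N (M x)\<close> and \<open>x\<close> bounds the left-hand side from above.\<close>

lemma quantile_comp_le_upper:
  assumes "a \<le> b" and M: "mono_on {a..b} M" and N: "mono_on {M a..M b} N" and u: "u \<le> N (M b)"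
  shows "quantile a b (N \<circ> M) u \<le> upper_quantile a b M (quantile (M a) (M b) N u)" (is "?q \<le> ?Xi")
proof (rule ccontr)
  let ?y = "quantile (M a) (M b) N u"
  assume "\<not> ?q \<le> ?Xi"
  then obtain x where x: "?Xi < x" "x < ?q" using dense[of ?Xi ?q] by auto
  have Mab: "M a \<le> M b" using assms mono_onD[OF M, of a b] by auto
  have "?y \<in> {M a..M b}" using Mab u by (rule quantile_in)
  then have "a \<le> ?Xi" using assms by (intro upper_quantile_ge) auto
  moreover have "?q \<le> b" using assms by (intro quantile_le) auto
  ultimately have xab: "x \<in> {a..b}" using x by auto
  have Mx: "M x \<in> {M a..M b}" using mono_onD[OF M, of a x] mono_onD[OF M, of x b] xab by auto
  have "?y < M x" using upper_quantile_ge[OF xab, of M ?y] x by (cases "M x \<le> ?y") auto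
  then have "u \<le> N (M x)" using le_of_quantile_less[OF N Mx _ u] by auto
  then have "?q \<le> x" using xab by (intro quantile_le) auto
  then show False using x by simp
qed

text \<open>For \<open>u \<le> N y\<close>, every \<open>x\<close> with \<open>y \<le> M x\<close>
  competes for the inverse of \<open>N \<circ> M\<close>. Together with
  \<open>quantile_comp_ge\<close> this gives the value \<open>X y\<close> on the left-jump set of
  \<open>y\<close>.\<close>

lemma quantile_comp_le:
  assumes "a \<le> b" and M: "mono_on {a..b} M" and N: "mono_on {M a..M b} N"
    and y: "y \<in> {M a..M b}" and u: "u \<le> N y"
  shows "quantile a b (N \<circ> M) u \<le> quantile a b M y"
proof (rule quantile_ge)
  fix x assume x: "x \<in> {a..b}" "y \<le> M x"
  have "M x \<in> {M a..M b}" using mono_onD[OF M, of a x] mono_onD[OF M, of x b] x by auto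
  then have "N y \<le> N (M x)" using mono_onD[OF N y] x by auto
  then show "quantile a b (N \<circ> M) u \<le> x" using x u by (intro quantile_le) auto
qed (use assms in auto)

text \<open>A point \<open>x\<close> with \<open>N y < u \<le> N (M x)\<close> has
  \<open>M x > y\<close>, so it lies to the right of all points where \<open>M \<le> y\<close>.
  Together with \<open>quantile_comp_le_upper\<close> this gives the value \<open>Xi y\<close> on
  the right-jump set of \<open>y\<close>.\<close>

lemma quantile_comp_ge_upper:
  assumes "a \<le> b" and M: "mono_on {a..b} M" and N: "mono_on {M a..M b} N"
    and y: "y \<in> {M a..M b}" and u: "N y < u" "u \<le> N (M b)"
  shows "upper_quantile a b M y \<le> quantile a b (N \<circ> M) u"
proof (rule quantile_ge)
  fix x assume x: "x \<in> {a..b}" "u \<le> (N \<circ> M) x"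
  show "upper_quantile a b M y \<le> x"
  proof (rule upper_quantile_le)
    fix x' assume x': "x' \<in> {a..b}" "M x' \<le> y"
    show "x' \<le> x"
    proof (rule ccontr)
      assume "\<not> x' \<le> x"
      then have "M x \<le> y" using mono_onD[OF M, of x x'] x x' by auto
      moreover have "M a \<le> M x" using mono_onD[OF M, of a x] x by auto
      ultimately have "N (M x) \<le> N y" using mono_onD[OF N, of "M x" y] y by auto
      then show False using x u by auto
    qed
  qed (use assms in auto)
qed (use assms in auto)

section \<open>Flat pieces of a monotone function\<close>

text \<open>On the open interval between the two inverses \<open>M\<close> is constantly
  \<open>y\<close>, so any two of its points serve. This is why \<open>X\<close> and
  \<open>Xi\<close> agree off \<open>H\<close>.\<close>

lemma flat_of_quantile_less_upper:
  assumes "a \<le> b" and M: "mono_on {a..b} M" and y: "y \<in> {M a..M b}"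
    and less: "quantile a b M y < upper_quantile a b M y"
  shows "\<exists>x1\<in>{a..b}. \<exists>x2\<in>{a..b}. x1 \<noteq> x2 \<and> M x1 = y \<and> M x2 = y"
proof -
  have flat: "x \<in> {a..b} \<and> M x = y" if x: "quantile a b M y < x" "x < upper_quantile a b M y" for x
  proof -
    have xab: "x \<in> {a..b}"
      using x quantile_in[of a b y M] upper_quantile_in[of a b M y] assms by auto
    have "M x \<le> y"
    proof (rule ccontr)
      assume n: "\<not> M x \<le> y"
      have "upper_quantile a b M y \<le> x"
      proof (rule upper_quantile_le)
        fix x' assume "x' \<in> {a..b}" "M x' \<le> y"
        then show "x' \<le> x" using mono_onD[OF M, of x x'] n xab by (cases "x' \<le> x") auto
      qed (use assms in auto)
      then show False using x by simp
    qed
    moreover have "y \<le> M x" using le_of_quantile_less[OF M xab x(1)] y by auto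
    ultimately show ?thesis using xab by auto
  qed
  obtain x1 where x1: "quantile a b M y < x1" "x1 < upper_quantile a b M y" using dense[OF less] by auto
  obtain x2 where x2: "x1 < x2" "x2 < upper_quantile a b M y" using dense[OF x1(2)] by auto
  have "x1 \<in> {a..b} \<and> M x1 = y" "x2 \<in> {a..b} \<and> M x2 = y" "x1 \<noteq> x2"
    using flat[of x1] flat[of x2] x1 x2 by auto
  then show ?thesis by blast
qed

text \<open>Two points with the same value enclose a rational at which monotonicity forces that
  value again.\<close>

lemma countable_flat_values:
  fixes M :: "real \<Rightarrow> real"
  assumes M: "mono_on {a..b} M"
  shows "countable {y. \<exists>x1\<in>{a..b}. \<exists>x2\<in>{a..b}. x1 \<noteq> x2 \<and> M x1 = y \<and> M x2 = y}"
proof (rule countable_subset)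
  show "countable (M ` \<rat>)" using countable_rat by (rule countable_image)
  have *: "M x1 \<in> M ` \<rat>" if x: "x1 \<in> {a..b}" "x2 \<in> {a..b}" "x1 < x2" "M x1 = M x2" for x1 x2
  proof -
    obtain q where q: "q \<in> \<rat>" "x1 < q" "q < x2" using Rats_dense_in_real[OF x(3)] by auto
    have "M q = M x1" using mono_onD[OF M, of x1 q] mono_onD[OF M, of q x2] q x by auto
    then show ?thesis using q by (metis imageI)
  qed
  show "{y. \<exists>x1\<in>{a..b}. \<exists>x2\<in>{a..b}. x1 \<noteq> x2 \<and> M x1 = y \<and> M x2 = y} \<subseteq> M ` \<rat>"
    using * by (smt (verit) mem_Collect_eq subsetI)
qed

section \<open>Removing the jumps at countably many points\<close>

text \<open>The right-hand side is the term at \<open>z\<close> of the sum subtracted in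
  \<open>N1\<close>. As \<open>x\<close> passes \<open>z\<close>, the part of the level set below
  \<open>N x\<close> goes from empty to the left jump at \<open>x = z\<close>, and then to the whole
  level set.\<close>

lemma measure_quantile_jump_below:
  fixes N :: "real \<Rightarrow> real"
  assumes N: "mono_on {c..d} N" and z: "z \<in> {c..d}" and x: "x \<in> {c..d}"
  shows "measure lborel {u \<in> {N c<..N x}. quantile c d N u = z} =
    (N z - left_lim_on c N z) * indicator {z..d} x + (right_lim_on d N z - N z) * indicator {z<..d} x"
proof -
  have cd: "c \<le> d" using z by auto
  have le: "N x \<le> N y" if "c \<le> x" "x \<le> y" "y \<le> d" for x y
    using mono_onD[OF N] that by auto
  consider "x < z" | "x = z" | "z < x" by linarith
  then show ?thesis
  proof cases
    case 1
    have "quantile c d N u \<le> x" if "u \<in> {N c<..N x}" for u using that x by (intro quantile_le) auto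
    then have "{u \<in> {N c<..N x}. quantile c d N u = z} = {}" using 1 by fastforce
    then show ?thesis using 1 by (simp only: measure_empty) simp
  next
    case 2
    then show ?thesis using measure_quantile_left_jump[OF N z] z by simp
  next
    case 3
    let ?L = "{u \<in> {N c<..N z}. quantile c d N u = z}" and ?R = "{u \<in> {N z<..N d}. quantile c d N u = z}"
    have "u \<le> N x" if "quantile c d N u = z" "u \<le> N d" for u
      using le_of_quantile_less[OF N x _ that(2)] that(1) 3 by auto
    then have eq: "{u \<in> {N c<..N x}. quantile c d N u = z} = ?L \<union> ?R"
      using le[of c z] le[of z x] le[of x d] 3 z x by (auto simp: not_le not_less)
    have mL: "?L \<in> sets lborel" using quantile_vimage_borel[of c d "N z" N "{z}" "N c"] le[of z d] z cd by auto
    have mR: "?R \<in> sets lborel" using quantile_vimage_borel[of c d "N d" N "{z}" "N z"] z cd by auto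
    have "measure lborel (?L \<union> ?R) = measure lborel ?L + measure lborel ?R"
      using mL mR by (intro measure_Un_fmeasurable_disjoint fmeasurable_Collect_Ioc) auto
    then show ?thesis using 3 x
      unfolding eq measure_quantile_left_jump[OF N z] measure_quantile_right_jump[OF N z] by simp
  qed
qed

text \<open>By countable additivity the subtracted sum is the length of the part of
  \<open>{N c<..N x}\<close> sent into \<open>H\<close>, so \<open>N1\<close> measures the rest.
  This is the hypothesis on \<open>F\<close> in \<open>LS_integral_quantile\<close>, for
  \<open>F = N1\<close>.\<close>

lemma remove_jumps_eq_measure:
  fixes N N1 :: "real \<Rightarrow> real"
  assumes cd: "c \<le> d" and N: "mono_on {c..d} N" and H: "countable H" "H \<subseteq> {c..d}"
    and N1: "\<And>y. N1 y = N y - (\<Sum>\<^sub>\<infinity>z\<in>H. (N z - left_lim_on c N z) * indicator {z..d} y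
                                     + (right_lim_on d N z - N z) * indicator {z<..d} y)"
    and x: "x \<in> {c..d}"
  shows "N1 x = N1 c + measure lborel ({u \<in> {N c<..N d}. quantile c d N u \<notin> H} \<inter> {..N x})"
proof -
  let ?q = "quantile c d N"
  let ?S = "\<lambda>x. {u \<in> {N c<..N x}. ?q u \<in> H}"
  have le: "N x \<le> N y" if "c \<le> x" "x \<le> y" "y \<le> d" for x y
    using mono_onD[OF N] that by auto
  have Hb: "H \<in> sets borel" using sets.countable[OF _ H(1), of borel] by auto
  have mb: "{u \<in> {N c<..N x}. ?q u \<in> T} \<in> sets lborel" if "x \<in> {c..d}" "T \<in> sets borel" for x T
    using quantile_vimage_borel[of c d "N x" N T "N c"] that le[of x d] cd by auto
  have fin: "{u \<in> {N c<..N x}. ?q u \<in> T} \<in> fmeasurable lborel" if "x \<in> {c..d}" "T \<in> sets borel" for x T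
    using mb[OF that] by (intro fmeasurable_Collect_Ioc) auto
  have N1x: "N1 x = N x - measure lborel (?S x)" if x: "x \<in> {c..d}" for x
  proof -
    let ?A = "\<lambda>z. {u \<in> {N c<..N x}. ?q u = z}"
    have U: "(\<Union>z\<in>H. ?A z) = ?S x" by auto
    \<comment> \<open>Level sets of distinct points are disjoint; the integrand 1 turns the
      integrals into lengths.\<close>
    have "((\<lambda>z. LINT u:?A z|lborel. 1::real) has_sum (LINT u:(\<Union>z\<in>H. ?A z)|lborel. 1)) H"
    proof (rule has_sum_set_integral_UN)
      show "?A z \<in> sets lborel" for z using mb[OF x, of "{z}"] by simp
      show "set_integrable lborel (\<Union>z\<in>H. ?A z) (\<lambda>u. 1::real)"
        unfolding U using fin[OF x Hb] by (simp add: set_integrable_def fmeasurable_def integrable_indicator_iff)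
    qed (use H in \<open>auto simp: disjoint_family_on_def\<close>)
    then have "((\<lambda>z. measure lborel (?A z)) has_sum measure lborel (?S x)) H"
      unfolding U by (simp add: set_lebesgue_integral_def)
    then have "((\<lambda>z. (N z - left_lim_on c N z) * indicator {z..d} x + (right_lim_on d N z - N z) * indicator {z<..d} x)
        has_sum measure lborel (?S x)) H"
      by (rule has_sum_cong[THEN iffD1, rotated]) (use H measure_quantile_jump_below[OF N _ x] in auto)
    then show ?thesis unfolding N1 by (simp add: infsumI)
  qed
  let ?E = "{u \<in> {N c<..N x}. ?q u \<in> - H}"
  have "measure lborel (?S x \<union> ?E) = measure lborel (?S x) + measure lborel ?E"
    by (rule measure_Un_fmeasurable_disjoint) (use fin[OF x, of H] fin[OF x, of "- H"] Hb in auto)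
  moreover have "?S x \<union> ?E = {N c<..N x}" by auto
  moreover have "{u \<in> {N c<..N d}. ?q u \<notin> H} \<inter> {..N x} = ?E"
    using le[of x d] x by auto
  \<comment> \<open>At \<open>c\<close> the interval \<open>{N c<..N c}\<close> is empty, so
    \<open>N1 c = N c\<close>.\<close>
  ultimately show ?thesis
    using N1x[OF x] N1x[of c] cd le[of c x] x by simp
qed

section \<open>The change of variables formula\<close>

theorem mainTheorem3:
  fixes a b :: real and M N f :: "real \<Rightarrow> real"
    and H :: "real set" and X Xi N1 :: "real \<Rightarrow> real"
    and dNm dNp :: "real \<Rightarrow> real"
  assumes ab: "a < b"
    and M_mono: "mono_on {a..b} M"
    and N_mono: "mono_on {M a..M b} N"
    and H_def: "H = {y \<in> {M a..M b}. \<exists>x1\<in>{a..b}. \<exists>x2\<in>{a..b}. x1 \<noteq> x2 \<and> M x1 = y \<and> M x2 = y}"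
    and X_def: "\<And>y. X y = Inf {x \<in> {a..b}. y \<le> M x}"
    and Xi_def: "\<And>y. Xi y = Sup {x \<in> {a..b}. M x \<le> y}"
    and dNm_def: "\<And>y. dNm y = N y - left_lim_on (M a) N y"
    and dNp_def: "\<And>y. dNp y = right_lim_on (M b) N y - N y"
    and N1_def: "\<And>y. N1 y = N y - (\<Sum>\<^sub>\<infinity>z\<in>H. dNm z * indicator {z..M b} y
                                         + dNp z * indicator {z<..M b} y)"
    and f_meas: "f \<in> borel_measurable (restrict_space borel {a..b})"
    and f_bdd: "bounded (f ` {a..b})"
  shows "LS_integral a b (N \<circ> M) f =
           LS_integral (M a) (M b) N1 (\<lambda>y. f (X y))
           + (\<Sum>\<^sub>\<infinity>y\<in>H. f (X y) * dNm y) + (\<Sum>\<^sub>\<infinity>y\<in>H. f (Xi y) * dNp y)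
       \<and> LS_integral (M a) (M b) N1 (\<lambda>y. f (X y)) = LS_integral (M a) (M b) N1 (\<lambda>y. f (Xi y))"
proof -
  \<comment> \<open>In the variable \<open>u\<close>, Lebesgue measure on \<open>P\<close> yields
    \<open>N \<circ> M\<close>, on \<open>E\<close> it yields \<open>N1\<close>, and
    \<open>L z\<close>, \<open>R z\<close> carry the left and right jump at
    \<open>z\<close>.\<close>
  define c d where "c = M a" and "d = M b"
  define P where "P = {N c<..N d}"
  define Y where "Y = quantile c d N"
  define q where "q = quantile a b (N \<circ> M)"
  define E where "E = {u \<in> P. Y u \<notin> H}"
  define L where "L z = {u \<in> {N c<..N z}. Y u = z}" for z
  define R where "R z = {u \<in> {N z<..N d}. Y u = z}" for z
  note X = X_def[folded quantile_def] and Xi = Xi_def[folded upper_quantile_def]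
  have ab': "a \<le> b" using ab by simp
  have Mle: "M x \<in> {c..d}" if "x \<in> {a..b}" for x
    using mono_onD[OF M_mono, of a x] mono_onD[OF M_mono, of x b] that by (auto simp: c_def d_def)
  have cd: "c \<le> d" using Mle[of a] ab by (auto simp: c_def)
  have N: "mono_on {c..d} N" using N_mono by (simp add: c_def d_def)
  have Nle: "N x \<le> N y" if "c \<le> x" "x \<le> y" "y \<le> d" for x y
    using mono_onD[OF N] that by auto
  have NM: "mono_on {a..b} (N \<circ> M)"
    using mono_onD[OF M_mono] Mle by (auto intro!: mono_onI Nle)
  have H: "H \<subseteq> {c..d}" by (auto simp: H_def c_def d_def)
  have Hc: "countable H"
    by (rule countable_subset[OF _ countable_flat_values[OF M_mono]]) (auto simp: H_def)
  have Hb: "H \<in> sets borel" using sets.countable[OF _ Hc, of borel] by auto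
  have Eb: "E \<in> sets borel"
    using quantile_vimage_borel[of c d "N d" N "- H" "N c"] cd Hb by (simp add: E_def P_def Y_def)
  have Lb: "L z \<in> sets borel" and Rb: "R z \<in> sets borel" if "z \<in> H" for z
    using quantile_vimage_borel[of c d "N z" N "{z}" "N c"] quantile_vimage_borel[of c d "N d" N "{z}" "N z"]
      that H cd Nle[of z d] by (auto simp: L_def R_def Y_def)
  have Lm: "measure lborel (L z) = dNm z" and Rm: "measure lborel (R z) = dNp z" if "z \<in> H" for z
    using measure_quantile_left_jump[OF N, of z] measure_quantile_right_jump[OF N, of z] that H
    by (auto simp: L_def R_def Y_def dNm_def dNp_def c_def d_def)

  have Yin: "Y u \<in> {c..d}" if "u \<in> P" for u
    using that cd quantile_in[of c d u N] by (simp add: Y_def P_def)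
  have X_le: "X (Y u) \<le> q u" and le_Xi: "q u \<le> Xi (Y u)" if "u \<in> P" for u
    using quantile_comp_ge[OF ab' M_mono, of u N] quantile_comp_le_upper[OF ab' M_mono N_mono, of u] that
    by (auto simp: X Xi Y_def q_def P_def c_def d_def)
  have XXi: "X (Y u) = Xi (Y u)" if "u \<in> E" for u
  proof (rule ccontr)
    assume "X (Y u) \<noteq> Xi (Y u)"
    \<comment> \<open>A strict gap would make \<open>M\<close> flat at height \<open>Y u\<close> and
      put \<open>Y u\<close> into \<open>H\<close>, which \<open>E\<close> excludes.\<close>
    then have "X (Y u) < Xi (Y u)" using that X_le[of u] le_Xi[of u] by (auto simp: E_def)
    then have "Y u \<in> H"
      using flat_of_quantile_less_upper[OF ab' M_mono, of "Y u"] Yin[of u] that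
      by (auto simp: X Xi H_def E_def c_def d_def)
    then show False using that by (simp add: E_def)
  qed
  have qE: "q u = X (Y u)" if "u \<in> E" for u
    using X_le[of u] le_Xi[of u] XXi[OF that] that by (auto simp: E_def)
  have LP: "u \<in> P" if "u \<in> L z" "z \<in> H" for u z
    using that H Nle[of z d] by (auto simp: L_def P_def)
  have RP: "u \<in> P" if "u \<in> R z" "z \<in> H" for u z
    using that H Nle[of c z] by (auto simp: R_def P_def)
  have qL: "q u = X z" if "u \<in> L z" "z \<in> H" for u z
  proof (rule antisym)
    show "q u \<le> X z"
      using quantile_comp_le[OF ab' M_mono N_mono, of z u] that H by (auto simp: q_def X L_def c_def d_def)
    show "X z \<le> q u" using X_le[OF LP[OF that]] that by (simp add: L_def)
  qed
  have qR: "q u = Xi z" if "u \<in> R z" "z \<in> H" for u z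
  proof (rule antisym)
    show "Xi z \<le> q u"
      using quantile_comp_ge_upper[OF ab' M_mono N_mono, of z u] that H
      by (auto simp: q_def Xi R_def c_def d_def)
    show "q u \<le> Xi z" using le_Xi[OF RP[OF that]] that by (simp add: R_def)
  qed

  have N1: "N1 x = N1 c + measure lborel (E \<inter> {..N x})" if "x \<in> {c..d}" for x
    using remove_jumps_eq_measure[OF cd N Hc H N1_def[unfolded dNm_def dNp_def, folded c_def d_def] that]
    by (simp add: E_def P_def Y_def)
  have NMm: "(N \<circ> M) x = (N \<circ> M) a + measure lborel (P \<inter> {..(N \<circ> M) x})" if "x \<in> {a..b}" for x
  proof -
    have "P \<inter> {..N (M x)} = {N c<..N (M x)}" using Mle[OF that] Nle[of "M x" d] by (auto simp: P_def)
    then show ?thesis using Mle[OF that] Nle[of c "M x"] by (simp add: c_def)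
  qed
  have fX: "(\<lambda>y. f (X y)) \<in> borel_measurable (restrict_space borel {c..d})"
    unfolding X by (rule measurable_compose[OF quantile_measurable f_meas]) (use ab' in \<open>auto simp: d_def\<close>)
  have fXi: "(\<lambda>y. f (Xi y)) \<in> borel_measurable (restrict_space borel {c..d})"
    unfolding Xi by (rule measurable_compose[OF upper_quantile_measurable f_meas]) (use ab' in \<open>auto simp: c_def\<close>)
  \<comment> \<open>The integrator is \<open>N1\<close>, but the inverse is still that of
    \<open>N\<close>; passing to \<open>N1\<close> only shrinks the domain of integration to
    \<open>E\<close>.\<close>
  have IX: "LS_integral c d N1 (\<lambda>y. f (X y)) = (LINT u:E|lborel. f (X (Y u)))"
    unfolding Y_def by (rule LS_integral_quantile[OF cd N _ _ N1 fX]) (use Eb in \<open>auto simp: E_def P_def\<close>)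
  have IXi: "LS_integral c d N1 (\<lambda>y. f (Xi y)) = (LINT u:E|lborel. f (Xi (Y u)))"
    unfolding Y_def by (rule LS_integral_quantile[OF cd N _ _ N1 fXi]) (use Eb in \<open>auto simp: E_def P_def\<close>)
  have I: "LS_integral a b (N \<circ> M) f = (LINT u:P|lborel. f (q u))"
    unfolding q_def by (rule LS_integral_quantile[OF ab' NM _ _ NMm f_meas]) (auto simp: P_def c_def d_def)

  obtain B where B: "\<And>x. x \<in> {a..b} \<Longrightarrow> \<bar>f x\<bar> \<le> B"
    using f_bdd by (fastforce simp: bounded_iff)
  have int: "set_integrable lborel P (\<lambda>u. f (q u))"
  proof (rule set_integrable_bounded_measurable)
    show "(\<lambda>u. f (q u)) \<in> borel_measurable (restrict_space borel P)"
      unfolding q_def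
      by (rule measurable_compose[OF quantile_measurable f_meas]) (use ab' in \<open>auto simp: P_def d_def\<close>)
    show "\<bar>f (q u)\<bar> \<le> B" if "u \<in> P" for u
      unfolding q_def by (intro B quantile_in) (use ab' that in \<open>auto simp: P_def d_def\<close>)
    show "emeasure lborel P < \<infinity>" using Nle[of c d] cd by (simp add: P_def)
  qed (simp add: P_def)
  have intS: "set_integrable lborel S (\<lambda>u. f (q u))" if "S \<subseteq> P" "S \<in> sets borel" for S
    using set_integrable_subset[OF int, of S] that by simp
  let ?L = "\<Union>z\<in>H. L z" and ?R = "\<Union>z\<in>H. R z"
  have ULb: "?L \<in> sets borel" and URb: "?R \<in> sets borel"
    using Lb Rb Hc by (auto intro!: sets.countable_UN')
  have ULP: "?L \<subseteq> P" and URP: "?R \<subseteq> P" using LP RP by blast+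
  have intL: "set_integrable lborel ?L (\<lambda>u. f (q u))" and intR: "set_integrable lborel ?R (\<lambda>u. f (q u))"
    using ULb URb ULP URP intS by blast+
  have EP: "E \<subseteq> P" by (auto simp: E_def)
  \<comment> \<open>If \<open>z = Y u\<close> lies in \<open>H\<close>, then \<open>u\<close> is in
    \<open>L z\<close> or \<open>R z\<close> according to \<open>u \<le> N z\<close> or
    \<open>u > N z\<close>.\<close>
  have Pdec: "P = E \<union> (?L \<union> ?R)"
  proof
    show "P \<subseteq> E \<union> (?L \<union> ?R)"
      by (auto simp: E_def L_def R_def P_def)
  qed (use EP ULP URP in auto)
  have "(LINT u:P|lborel. f (q u)) = (LINT u:E|lborel. f (q u)) + (LINT u:?L \<union> ?R|lborel. f (q u))"
    unfolding Pdec
  proof (rule set_integral_Un)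
    show "set_integrable lborel E (\<lambda>u. f (q u))" using intS Eb EP by blast
    show "set_integrable lborel (?L \<union> ?R) (\<lambda>u. f (q u))"
      using ULb URb ULP URP by (intro intS) auto
  qed (auto simp: E_def L_def R_def)
  also have "(LINT u:?L \<union> ?R|lborel. f (q u)) = (LINT u:?L|lborel. f (q u)) + (LINT u:?R|lborel. f (q u))"
    by (rule set_integral_Un) (use intL intR in \<open>auto simp: L_def R_def\<close>)
  also have "(LINT u:?L|lborel. f (q u)) = (\<Sum>\<^sub>\<infinity>y\<in>H. f (X y) * dNm y)"
  proof -
    have "((\<lambda>z. LINT u:L z|lborel. f (q u)) has_sum (LINT u:?L|lborel. f (q u))) H"
      by (rule has_sum_set_integral_UN[OF Hc _ _ intL])
        (use Lb in \<open>auto simp: disjoint_family_on_def L_def\<close>)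
    moreover have "(LINT u:L z|lborel. f (q u)) = f (X z) * dNm z" if z: "z \<in> H" for z
    proof -
      \<comment> \<open>The integrand is constant on \<open>L z\<close>, so only its length, the
        left jump, remains.\<close>
      have "(LINT u:L z|lborel. f (q u)) = (LINT u:L z|lborel. f (X z))"
        using Lb[OF z] qL[OF _ z] by (intro set_lebesgue_integral_cong) auto
      also have "\<dots> = f (X z) * dNm z"
        using Lb[OF z] by (simp add: set_lebesgue_integral_def Lm[OF z])
      finally show ?thesis .
    qed
    ultimately have "((\<lambda>z. f (X z) * dNm z) has_sum (LINT u:?L|lborel. f (q u))) H"
      by (simp cong: has_sum_cong)
    then show ?thesis by (simp add: infsumI)
  qed
  also have "(LINT u:?R|lborel. f (q u)) = (\<Sum>\<^sub>\<infinity>y\<in>H. f (Xi y) * dNp y)"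
  proof -
    have "((\<lambda>z. LINT u:R z|lborel. f (q u)) has_sum (LINT u:?R|lborel. f (q u))) H"
      by (rule has_sum_set_integral_UN[OF Hc _ _ intR])
        (use Rb in \<open>auto simp: disjoint_family_on_def R_def\<close>)
    moreover have "(LINT u:R z|lborel. f (q u)) = f (Xi z) * dNp z" if z: "z \<in> H" for z
    proof -
      have "(LINT u:R z|lborel. f (q u)) = (LINT u:R z|lborel. f (Xi z))"
        using Rb[OF z] qR[OF _ z] by (intro set_lebesgue_integral_cong) auto
      also have "\<dots> = f (Xi z) * dNp z"
        using Rb[OF z] by (simp add: set_lebesgue_integral_def Rm[OF z])
      finally show ?thesis .
    qed
    ultimately have "((\<lambda>z. f (Xi z) * dNp z) has_sum (LINT u:?R|lborel. f (q u))) H"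
      by (simp cong: has_sum_cong)
    then show ?thesis by (simp add: infsumI)
  qed
  also have "(LINT u:E|lborel. f (q u)) = (LINT u:E|lborel. f (X (Y u)))"
    using Eb qE by (intro set_lebesgue_integral_cong) auto
  finally have 1: "LS_integral a b (N \<circ> M) f = LS_integral c d N1 (\<lambda>y. f (X y))
           + (\<Sum>\<^sub>\<infinity>y\<in>H. f (X y) * dNm y) + (\<Sum>\<^sub>\<infinity>y\<in>H. f (Xi y) * dNp y)"
    by (simp add: I IX)
  have "(LINT u:E|lborel. f (X (Y u))) = (LINT u:E|lborel. f (Xi (Y u)))"
    using Eb XXi by (intro set_lebesgue_integral_cong) auto
  then have 2: "LS_integral c d N1 (\<lambda>y. f (X y)) = LS_integral c d N1 (\<lambda>y. f (Xi y))"
    by (simp add: IX IXi)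
  show ?thesis using 1 2 by (simp add: c_def d_def)
qed

end
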